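(* Let $E$ be a row-finite directed graph. Then the monoid $M_E$ is separative.
   Context: A directed graph $E=(E^0,E^1)$ consists of a vertex set $E^0$, an edge set $E^1$, and maps $r,s\colon E^1\to E^0$ (range and source). A vertex $v$ emits edges if $s^{-1}(v)\neq\emptyset$. $E$ is row-finite if each vertex emits only finitely many edges. $M_E$ is the abelian monoid with generators $\{a_v\mid v\in E^0\}$ and relations $a_v=\sum_{\{e\in E^1\mid s(e)=v\}}a_{r(e)}$ for every $v\in E^0$ that emits edges. The algebraic pre-order on an abelian monoid $M$ is: $x\le y$ iff $y=x+z$ for some $z\in M$. $M$ is separative if, for $a,b,c\in M$, $a+c=b+c$ together with $c\le na$ and $c\le nb$ for some positive integer $n$ implies $a=b$. *)

theory Defs
  imports "HOL-Algebra.Divisibility" "HOL-Library.Multiset" "Graph_Theory.Digraph"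
begin

text \<open>Directed graphs are those of \<^locale>\<open>wf_digraph\<close>: loops and parallel
  arcs are allowed, and both \<^term>\<open>verts E\<close> and \<^term>\<open>arcs E\<close> may be infinite.
  Source and range are \<^term>\<open>tail E\<close> and \<^term>\<open>head E\<close>.\<close>

locale row_finite_digraph = wf_digraph E for E :: "('a, 'b) pre_digraph" +
  assumes finite_out_arcs: "v \<in> verts E \<Longrightarrow> finite (out_arcs E v)"

text \<open>The free abelian monoid on \<^term>\<open>verts E\<close> is the set of multisets supported
  in \<^term>\<open>verts E\<close>; the following is the congruence on it generated by the
  relations of the graph monoid.  As \<^const>\<open>mset_set\<close> sends infinite sets to the empty
  multiset, this is meaningful for row-finite graphs only.\<close>

inductive graph_cong :: "('a, 'b) pre_digraph \<Rightarrow> 'a multiset \<Rightarrow> 'a multiset \<Rightarrow> bool"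
  for E :: "('a, 'b) pre_digraph" where
  gen: "v \<in> verts E \<Longrightarrow> out_arcs E v \<noteq> {} \<Longrightarrow>
    graph_cong E {#v#} (image_mset (head E) (mset_set (out_arcs E v)))"
| refl: "set_mset x \<subseteq> verts E \<Longrightarrow> graph_cong E x x"
| sym: "graph_cong E x y \<Longrightarrow> graph_cong E y x"
| trans: "graph_cong E x y \<Longrightarrow> graph_cong E y z \<Longrightarrow> graph_cong E x z"
| add: "graph_cong E x y \<Longrightarrow> graph_cong E x' y' \<Longrightarrow> graph_cong E (x + x') (y + y')"

definition graph_class :: "('a, 'b) pre_digraph \<Rightarrow> 'a multiset \<Rightarrow> 'a multiset set" where
  "graph_class E x = {y. graph_cong E x y}"

text \<open>The abelian monoid is written multiplicatively, as usual for \<^locale>\<open>comm_monoid\<close>.\<close>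

definition graph_monoid :: "('a, 'b) pre_digraph \<Rightarrow> 'a multiset set monoid" where
  "graph_monoid E =
    \<lparr> carrier = graph_class E ` {x. set_mset x \<subseteq> verts E},
      mult = (\<lambda>A B. \<Union>x\<in>A. \<Union>y\<in>B. graph_class E (x + y)),
      one = graph_class E {#} \<rparr>"

text \<open>The algebraic pre-order \<open>x \<le> y\<close>, i.e. \<open>y = x + z\<close> for some \<open>z\<close>, is
  divisibility \<^const>\<open>factor\<close> in multiplicative notation, and \<open>n a\<close> is the power \<open>a [^] n\<close>.\<close>

locale separative_monoid = comm_monoid M for M (structure) +
  assumes separative:
    "\<lbrakk> a \<in> carrier M; b \<in> carrier M; c \<in> carrier M; a \<otimes> c = b \<otimes> c;
       \<exists>n::nat. n > 0 \<and> c divides (a [^] n) \<and> c divides (b [^] n) \<rbrakk> \<Longrightarrow> a = b"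

lemma (in row_finite_digraph) graph_cong_verts:
  assumes "graph_cong E x y"
  shows "set_mset x \<subseteq> verts E \<and> set_mset y \<subseteq> verts E"
  using assms
proof induction
  case (gen v)
  then show ?case using finite_out_arcs[of v] by (auto simp: out_arcs_def)
qed auto

lemma graph_class_eq_iff:
  assumes "set_mset y \<subseteq> verts E"
  shows "graph_class E x = graph_class E y \<longleftrightarrow> graph_cong E x y"
  using assms unfolding graph_class_def
  by (auto intro: graph_cong.intros)

lemma graph_monoid_mult:
  assumes "set_mset x \<subseteq> verts E" "set_mset y \<subseteq> verts E"
  shows "graph_class E x \<otimes>\<^bsub>graph_monoid E\<^esub> graph_class E y = graph_class E (x + y)"
  using assms unfolding graph_monoid_def graph_class_def
  by (auto intro: graph_cong.intros)

lemma comm_monoid_graph_monoid: "comm_monoid (graph_monoid E)"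
proof -
  have c: "carrier (graph_monoid E) = graph_class E ` {x. set_mset x \<subseteq> verts E}"
    and o: "\<one>\<^bsub>graph_monoid E\<^esub> = graph_class E {#}"
    by (simp_all add: graph_monoid_def)
  show ?thesis
    by (rule comm_monoidI) (auto simp: c o graph_monoid_mult add_ac)
qed

end

theory Submission
  imports Defs "HOL-Library.Confluence"
begin

text \<open>
  Orient each relation of the graph monoid as a rewriting step that replaces one copy of an
  emitting vertex by the multiset of its successors.  Two such steps at different copies
  commute, so the rewriting is confluent: equal elements of the monoid have a common reduct
  (\<open>graph_cong_imp_joinable\<close>).  Moreover a reduct of a sum is a sum of reducts of the summands
  (\<open>rtranclp_fires_split\<close>).

  Separativity then reduces to vertices.  If \<open>c \<le> n a\<close> and \<open>c \<le> n b\<close>, then \<open>c\<close> rewrites to a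
  sum of vertices each of which is reachable both from a vertex of \<open>a\<close> and from a vertex of \<open>b\<close>,
  hence lies below both \<open>a\<close> and \<open>b\<close>.  Such vertices can be removed from \<open>a + c = b + c\<close> one by
  one, provided that each vertex \<open>v\<close> satisfies: \<open>a + 2 v = b + 2 v\<close> implies \<open>a + v = b + v\<close>
  (\<open>cancels\<close>).  This is proved by looking at the set \<open>C\<close> of vertices that can reach \<open>v\<close> and are
  reachable from it.

  \<^item> If \<open>v\<close> is a sink, even \<open>v\<close> itself cancels, as it never rewrites.
  \<^item> If \<open>v\<close> emits edges but lies on no cycle, replace it by its successors and argue by
    induction (\<open>cancels_nonsink\<close>).
  \<^item> If some vertex of \<open>C\<close> has two edges into \<open>C\<close>, then \<open>v = 2 v + r\<close> for some \<open>r\<close>, and the claim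
    follows by adding \<open>r\<close> (\<open>cancels_branching\<close>).
  \<^item> Otherwise \<open>C\<close> is a single cycle.  Every reduct of \<open>v\<close> contains exactly one vertex of
    \<open>C\<close>, and moving that vertex on to \<open>v\<close> shows that all the rest of the reduct is absorbed by \<open>v\<close>.
    Counting the vertices of \<open>C\<close> in a common reduct of \<open>a + 2 v\<close> and \<open>b + 2 v\<close> gives the
    claim (\<open>cancels_cycle\<close>).

  The induction in the second case needs the graph to be finite below \<open>v\<close>.  This is harmless: an
  equality in the monoid uses finitely many of the relations, so it already holds for a subgraph
  in which only finitely many vertices emit edges (\<open>graph_cong_finite_emitters\<close>).
\<close>

section \<open>The graph monoid as a rewriting system\<close>

abbreviation succs :: "('a, 'b) pre_digraph \<Rightarrow> 'a \<Rightarrow> 'a multiset" where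
  "succs E v \<equiv> image_mset (head E) (mset_set (out_arcs E v))"

definition fires :: "('a, 'b) pre_digraph \<Rightarrow> 'a multiset \<Rightarrow> 'a multiset \<Rightarrow> bool" where
  "fires E x y \<longleftrightarrow>
    (\<exists>v w. out_arcs E v \<noteq> {} \<and> x = add_mset v w \<and> y = succs E v + w)"

lemma firesI: "out_arcs E v \<noteq> {} \<Longrightarrow> fires E (add_mset v w) (succs E v + w)"
  unfolding fires_def by blast

lemma fires_add: "fires E x y \<Longrightarrow> fires E (x + z) (y + z)"
  unfolding fires_def by (metis add.assoc add_mset_add_single union_mset_add_mset_left)

lemma rtranclp_fires_add_right:
  assumes "(fires E)\<^sup>*\<^sup>* x y"
  shows "(fires E)\<^sup>*\<^sup>* (x + z) (y + z)"
  using assms by induction (auto intro: rtranclp.rtrancl_into_rtrancl fires_add)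

lemma rtranclp_fires_add:
  assumes "(fires E)\<^sup>*\<^sup>* x y" "(fires E)\<^sup>*\<^sup>* x' y'"
  shows "(fires E)\<^sup>*\<^sup>* (x + x') (y + y')"
  using rtranclp_fires_add_right[OF assms(1), of x'] rtranclp_fires_add_right[OF assms(2), of y]
  by (simp add: add.commute)

text \<open>Steps at two distinct vertices act on disjoint parts of the multiset, so they commute; a
  vertex has only one step, which rewrites to all of its successors.\<close>

lemma confluentp_fires: "confluentp (fires E)"
proof (rule strong_confluentp_imp_confluentp, rule strong_confluentpI)
  fix x y z assume "fires E x y" "fires E x z"
  then obtain u s v t where u: "out_arcs E u \<noteq> {}" "x = add_mset u s" "y = succs E u + s"
    and v: "out_arcs E v \<noteq> {}" "x = add_mset v t" "z = succs E v + t"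
    unfolding fires_def by blast
  show "\<exists>w. (fires E)\<^sup>*\<^sup>* y w \<and> (fires E)\<^sup>=\<^sup>= z w"
  proof (cases "u = v")
    case True
    then show ?thesis using u v by auto
  next
    case False
    then obtain w where w: "s = add_mset v w" "t = add_mset u w"
      using u(2) v(2) by (metis add_eq_conv_ex)
    have "fires E y (succs E v + (succs E u + w))"
      using firesI[OF v(1), of "succs E u + w"] u(3) w by simp
    moreover have "fires E z (succs E v + (succs E u + w))"
      using firesI[OF u(1), of "succs E v + w"] v(3) w by (simp add: ac_simps)
    ultimately show ?thesis by blast
  qed
qed

text \<open>Every step consumes a single vertex, which belongs to one of the two summands; this is
  what makes the graph monoid a refinement monoid.\<close>

lemma rtranclp_fires_split:
  assumes "(fires E)\<^sup>*\<^sup>* (x1 + x2) z"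
  shows "\<exists>z1 z2. z = z1 + z2 \<and> (fires E)\<^sup>*\<^sup>* x1 z1 \<and> (fires E)\<^sup>*\<^sup>* x2 z2"
  using assms
proof (induction z)
  case base
  then show ?case by blast
next
  case (step y z)
  then obtain y1 y2 where y: "y = y1 + y2" "(fires E)\<^sup>*\<^sup>* x1 y1" "(fires E)\<^sup>*\<^sup>* x2 y2" by blast
  from step.hyps(2) obtain v w where v: "out_arcs E v \<noteq> {}" "y = add_mset v w" "z = succs E v + w"
    unfolding fires_def by blast
  then have "v \<in># y1 + y2" using y(1) by (metis union_single_eq_member)
  then consider w1 where "y1 = add_mset v w1" | w2 where "y2 = add_mset v w2"
    by (meson multi_member_split union_iff)
  then show ?case
  proof cases
    case 1
    then have "z = (succs E v + w1) + y2" using v y(1) by (simp add: ac_simps)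
    moreover have "(fires E)\<^sup>*\<^sup>* x1 (succs E v + w1)"
      using 1 y firesI[OF v(1), of w1] by (metis rtranclp.rtrancl_into_rtrancl)
    ultimately show ?thesis using y by blast
  next
    case 2
    then have "z = y1 + (succs E v + w2)" using v y(1) by (simp add: ac_simps)
    moreover have "(fires E)\<^sup>*\<^sup>* x2 (succs E v + w2)"
      using 2 y firesI[OF v(1), of w2] by (metis rtranclp.rtrancl_into_rtrancl)
    ultimately show ?thesis using y by blast
  qed
qed

lemma graph_cong_imp_joinable:
  assumes "graph_cong E x y"
  shows "\<exists>z. (fires E)\<^sup>*\<^sup>* x z \<and> (fires E)\<^sup>*\<^sup>* y z"
  using assms
proof induction
  case (gen v)
  then show ?case using firesI[of E v "{#}"] by auto
next
  case (trans x y z)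
  then show ?case by (meson confluentpD confluentp_fires rtranclp_trans)
next
  case (add x y x' y')
  then show ?case by (meson rtranclp_fires_add)
qed blast+

lemma set_repeat_mset_subset: "set_mset (repeat_mset n x) \<subseteq> set_mset x"
  by (induction n) auto

context row_finite_digraph
begin

abbreviation cong (infix \<open>\<approx>\<close> 50) where "x \<approx> y \<equiv> graph_cong E x y"

declare graph_cong.trans [trans]

lemma cong_refl: "set_mset x \<subseteq> verts E \<Longrightarrow> x \<approx> x"
  by (rule graph_cong.refl)

lemma cong_sym: "x \<approx> y \<Longrightarrow> y \<approx> x"
  by (rule graph_cong.sym)

lemma cong_trans2: "x \<approx> x' \<Longrightarrow> x' \<approx> y' \<Longrightarrow> y \<approx> y' \<Longrightarrow> x \<approx> y"
  by (meson graph_cong.sym graph_cong.trans)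

lemma cong_supp:
  assumes "x \<approx> y"
  shows "set_mset x \<subseteq> verts E" "set_mset y \<subseteq> verts E"
  using graph_cong_verts[OF assms] by auto

lemma cong_add_right: "x \<approx> y \<Longrightarrow> set_mset z \<subseteq> verts E \<Longrightarrow> x + z \<approx> y + z"
  by (rule graph_cong.add[OF _ cong_refl])

lemma finite_out: "finite (out_arcs E v)"
proof (cases "v \<in> verts E")
  case False
  then have "out_arcs E v = {}" by (auto simp: out_arcs_def)
  then show ?thesis by simp
qed (rule finite_out_arcs)

lemma set_succs: "set_mset (succs E v) = arcs_ends E `` {v}"
  using finite_out[of v] by (auto simp: arcs_ends_conv)

lemma arcs_ends_verts: "(u, v) \<in> arcs_ends E \<Longrightarrow> u \<in> verts E \<and> v \<in> verts E"
  by (auto simp: arcs_ends_conv)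

lemma arcs_ends_out_arcs: "out_arcs E v \<noteq> {} \<longleftrightarrow> (\<exists>u. (v, u) \<in> arcs_ends E)"
  by (force simp: arcs_ends_conv)

lemma succs_cong: "out_arcs E v \<noteq> {} \<Longrightarrow> {#v#} \<approx> succs E v"
  using arcs_ends_out_arcs arcs_ends_verts by (blast intro: graph_cong.gen)

lemma fires_cong:
  assumes "fires E x y" "set_mset x \<subseteq> verts E"
  shows "x \<approx> y"
proof -
  obtain v w where v: "out_arcs E v \<noteq> {}" "x = add_mset v w" "y = succs E v + w"
    using assms(1) unfolding fires_def by blast
  then show ?thesis using cong_add_right[OF succs_cong[OF v(1)], of w] assms(2) by simp
qed

lemma rtranclp_fires_cong:
  assumes "(fires E)\<^sup>*\<^sup>* x y" "set_mset x \<subseteq> verts E"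
  shows "x \<approx> y"
  using assms
proof induction
  case base
  then show ?case by (rule cong_refl)
next
  case (step y z)
  then have xy: "x \<approx> y" by simp
  with step.hyps(2) have "y \<approx> z" using fires_cong cong_supp(2) by blast
  with xy show ?case by (rule graph_cong.trans)
qed

section \<open>Reachability and divisibility\<close>

lemma rtranclp_fires_reach:
  assumes "(fires E)\<^sup>*\<^sup>* x y" "w \<in># y"
  shows "\<exists>u. u \<in># x \<and> (u, w) \<in> (arcs_ends E)\<^sup>*"
  using assms
proof (induction arbitrary: w)
  case base
  then show ?case by blast
next
  case (step y z)
  obtain v t where v: "out_arcs E v \<noteq> {}" "y = add_mset v t" "z = succs E v + t"
    using step.hyps(2) unfolding fires_def by blast
  show ?case
  proof (cases "w \<in># t")
    case True
    then show ?thesis using step.IH v(2) by simp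
  next
    case False
    then have "(v, w) \<in> arcs_ends E" using step.prems v(3) set_succs[of v] by auto
    moreover obtain u where "u \<in># x" "(u, v) \<in> (arcs_ends E)\<^sup>*"
      using step.IH[of v] v(2) by auto
    ultimately show ?thesis by (meson rtrancl.rtrancl_into_rtrancl)
  qed
qed

lemma reach_verts: "(u, w) \<in> (arcs_ends E)\<^sup>* \<Longrightarrow> u \<in> verts E \<Longrightarrow> w \<in> verts E"
  by (induction rule: rtrancl_induct) (auto dest: arcs_ends_verts)

lemma reach_fires:
  assumes "(u, w) \<in> (arcs_ends E)\<^sup>*"
  shows "\<exists>t. (fires E)\<^sup>*\<^sup>* {#u#} (add_mset w t)"
  using assms
proof (induction rule: rtrancl_induct)
  case base
  then show ?case by blast
next
  case (step y z)
  then obtain t where t: "(fires E)\<^sup>*\<^sup>* {#u#} (add_mset y t)" by blast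
  have "z \<in># succs E y" using step.hyps(2) set_succs by auto
  then obtain s where s: "succs E y = add_mset z s" by (meson multi_member_split)
  have "out_arcs E y \<noteq> {}" using step.hyps(2) arcs_ends_out_arcs by blast
  from firesI[OF this, of t] have "fires E (add_mset y t) (add_mset z (s + t))"
    using s by simp
  with t show ?case by (meson rtranclp.rtrancl_into_rtrancl)
qed

text \<open>Paths turn into the algebraic pre-order: rewriting along a path from \<open>u\<close> to \<open>w\<close> shows
  \<open>w \<le> u\<close>.\<close>

lemma reach_divides:
  assumes "u \<in># x" "set_mset x \<subseteq> verts E" "(u, w) \<in> (arcs_ends E)\<^sup>*"
  shows "\<exists>t. x \<approx> add_mset w t"
proof -
  obtain y where y: "x = add_mset u y" using assms(1) by (meson multi_member_split)
  obtain t where "(fires E)\<^sup>*\<^sup>* {#u#} (add_mset w t)" using reach_fires[OF assms(3)] by blast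
  then have "{#u#} \<approx> add_mset w t" using rtranclp_fires_cong assms(2) y by simp
  from cong_add_right[OF this, of y] have "x \<approx> add_mset w (t + y)" using y assms(2) by simp
  then show ?thesis by blast
qed

section \<open>Cancelling one of two copies of a vertex\<close>

text \<open>Demanding this for all elements \<open>v\<close> of an abelian monoid is a well-known equivalent of
  separativity.  Here it is stated for the generators only.\<close>

definition cancels :: "'a \<Rightarrow> bool" where
  "cancels v \<longleftrightarrow>
    (\<forall>a b. add_mset v (add_mset v a) \<approx> add_mset v (add_mset v b) \<longrightarrow>
       add_mset v a \<approx> add_mset v b)"

text \<open>The vertices of \<open>x\<close> are removed one at a time.  To remove \<open>u\<close>, absorb it into \<open>a\<close> and \<open>b\<close>, which
  the induction hypothesis for the remaining vertices then equates: \<open>a + u = b + u\<close>.  Since \<open>a\<close>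
  and \<open>b\<close> already contain \<open>u\<close>, this is an instance of the defining property of \<open>cancels\<close>.\<close>

lemma cancel_dominated:
  assumes "a + x \<approx> b + x"
    and "\<And>u. u \<in># x \<Longrightarrow> cancels u"
    and "\<And>u. u \<in># x \<Longrightarrow> \<exists>a'. a \<approx> add_mset u a'"
    and "\<And>u. u \<in># x \<Longrightarrow> \<exists>b'. b \<approx> add_mset u b'"
  shows "a \<approx> b"
  using assms
proof (induction x arbitrary: a b)
  case empty
  then show ?case by simp
next
  case (add u x)
  have u: "u \<in> verts E" using cong_supp(1)[OF add.prems(1)] by simp
  have lift: "\<exists>c'. add_mset u c \<approx> add_mset w c'" if "c \<approx> add_mset w d" for c d w
    using cong_add_right[OF that, of "{#u#}"] u by (auto simp: add_mset_commute[of u w])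
  have "add_mset u a \<approx> add_mset u b"
  proof (rule add.IH)
    show "add_mset u a + x \<approx> add_mset u b + x" using add.prems(1) by simp
  next
    fix w assume w: "w \<in># x"
    then show "cancels w" using add.prems(2) by simp
    show "\<exists>a'. add_mset u a \<approx> add_mset w a'" "\<exists>b'. add_mset u b \<approx> add_mset w b'"
      using w add.prems(3,4)[of w] lift by auto
  qed
  moreover obtain a' b' where a': "a \<approx> add_mset u a'" and b': "b \<approx> add_mset u b'"
    using add.prems(3,4)[of u] by auto
  moreover have "add_mset u a \<approx> add_mset u (add_mset u a')"
    "add_mset u b \<approx> add_mset u (add_mset u b')"
    using cong_add_right[OF a', of "{#u#}"] cong_add_right[OF b', of "{#u#}"] u by auto
  ultimately have "add_mset u (add_mset u a') \<approx> add_mset u (add_mset u b')"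
    by (meson cong_sym cong_trans2)
  then have "add_mset u a' \<approx> add_mset u b'"
    using add.prems(2)[of u] unfolding cancels_def by auto
  then show ?case using a' b' by (meson cong_trans2)
qed

lemma cancels_sink:
  assumes "out_arcs E v = {}"
  shows "cancels v"
  unfolding cancels_def
proof (intro allI impI)
  fix a b assume ab: "add_mset v (add_mset v a) \<approx> add_mset v (add_mset v b)"
  have sink: "z = {#v#}" if "(fires E)\<^sup>*\<^sup>* {#v#} z" for z
    using that by (induction, use assms in \<open>auto simp: fires_def\<close>)
  obtain z where z: "(fires E)\<^sup>*\<^sup>* ({#v#} + add_mset v a) z" "(fires E)\<^sup>*\<^sup>* ({#v#} + add_mset v b) z"
    using graph_cong_imp_joinable[OF ab] by auto
  obtain z1 where z1: "z = add_mset v z1" "(fires E)\<^sup>*\<^sup>* (add_mset v a) z1"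
    using rtranclp_fires_split[OF z(1)] sink by fastforce
  obtain z2 where z2: "z = add_mset v z2" "(fires E)\<^sup>*\<^sup>* (add_mset v b) z2"
    using rtranclp_fires_split[OF z(2)] sink by fastforce
  have "z1 = z2" using z1 z2 by simp
  then have "add_mset v a \<approx> z1" "add_mset v b \<approx> z1"
    using z1 z2 rtranclp_fires_cong cong_supp[OF ab] by auto
  then show "add_mset v a \<approx> add_mset v b" by (rule graph_cong.trans[OF _ cong_sym])
qed

text \<open>In \<open>(a + v) + v = (b + v) + v\<close> replace the last \<open>v\<close> by its successors; they lie below \<open>v\<close>,
  hence below \<open>a + v\<close> and \<open>b + v\<close>.\<close>

lemma cancels_nonsink:
  assumes v: "out_arcs E v \<noteq> {}" and succ: "\<And>u. (v, u) \<in> arcs_ends E \<Longrightarrow> cancels u"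
  shows "cancels v"
  unfolding cancels_def
proof (intro allI impI)
  fix a b assume ab: "add_mset v (add_mset v a) \<approx> add_mset v (add_mset v b)"
  have supp: "set_mset (add_mset v a) \<subseteq> verts E" "set_mset (add_mset v b) \<subseteq> verts E"
    using cong_supp[OF ab] by auto
  have expand: "add_mset v a + succs E v \<approx> add_mset v (add_mset v a)"
    if "set_mset (add_mset v a) \<subseteq> verts E" for a
    using cong_add_right[OF succs_cong[OF v] that] by (auto intro: cong_sym simp: ac_simps)
  have dom: "\<exists>t. add_mset v a \<approx> add_mset u t"
    if "set_mset (add_mset v a) \<subseteq> verts E" "u \<in># succs E v" for a u
    using reach_divides[of v "add_mset v a" u] that set_succs[of v] by auto
  show "add_mset v a \<approx> add_mset v b"
  proof (rule cancel_dominated)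
    show "add_mset v a + succs E v \<approx> add_mset v b + succs E v"
      using expand[OF supp(1)] expand[OF supp(2)] ab
      by (meson cong_sym cong_trans2)
  qed (use succ set_succs[of v] dom supp in auto)
qed

text \<open>Here \<open>a + v = a + 2 v + r = b + 2 v + r = b + v\<close>.\<close>

lemma cancels_absorbing:
  assumes "{#v#} \<approx> add_mset v (add_mset v r)"
  shows "cancels v"
  unfolding cancels_def
proof (intro allI impI)
  fix a b assume ab: "add_mset v (add_mset v a) \<approx> add_mset v (add_mset v b)"
  have "add_mset v a \<approx> add_mset v (add_mset v a) + r"
    if "set_mset a \<subseteq> verts E" for a
    using cong_add_right[OF assms that] by (simp add: ac_simps)
  from this[of a] this[of b] have "add_mset v a \<approx> add_mset v (add_mset v a) + r"
    "add_mset v b \<approx> add_mset v (add_mset v b) + r" using cong_supp[OF ab] by auto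
  moreover have "add_mset v (add_mset v a) + r \<approx> add_mset v (add_mset v b) + r"
    using cong_add_right[OF ab, of r] cong_supp(2)[OF assms] by simp
  ultimately show "add_mset v a \<approx> add_mset v b"
    by (meson cong_sym cong_trans2)
qed

text \<open>Walking from \<open>v\<close> to \<open>w\<close>, branching to \<open>w1\<close> and \<open>w2\<close>, and returning to \<open>v\<close> from
  both reproduces \<open>v\<close> twice.\<close>

lemma cancels_branching:
  assumes v: "v \<in> verts E"
    and w: "(v, w) \<in> (arcs_ends E)\<^sup>*" "succs E w = add_mset w1 (add_mset w2 y)"
    and ret: "(w1, v) \<in> (arcs_ends E)\<^sup>*" "(w2, v) \<in> (arcs_ends E)\<^sup>*"
  shows "cancels v"
proof -
  have "w1 \<in># succs E w" using w(2) by simp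
  then have out: "out_arcs E w \<noteq> {}" using set_succs arcs_ends_out_arcs by auto
  obtain t where t: "{#v#} \<approx> add_mset w t"
    using reach_divides[of v "{#v#}" w] v w(1) by auto
  have supp: "set_mset t \<subseteq> verts E" using cong_supp(2)[OF t] by simp
  have s: "add_mset w t \<approx> add_mset w1 (add_mset w2 y) + t"
    using cong_add_right[OF succs_cong[OF out] supp] w(2) by simp
  have verts: "w1 \<in> verts E" "w2 \<in> verts E" "set_mset y \<subseteq> verts E" using cong_supp(2)[OF s] by auto
  obtain s1 where s1: "{#w1#} \<approx> add_mset v s1"
    using reach_divides[of w1 "{#w1#}" v] verts ret by auto
  obtain s2 where s2: "{#w2#} \<approx> add_mset v s2"
    using reach_divides[of w2 "{#w2#}" v] verts ret by auto
  have "({#w1#} + {#w2#}) + (y + t) \<approx> (add_mset v s1 + add_mset v s2) + (y + t)"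
    by (rule cong_add_right[OF graph_cong.add[OF s1 s2]]) (use verts supp in auto)
  then have "add_mset w1 (add_mset w2 y) + t \<approx> add_mset v (add_mset v (s1 + s2 + (y + t)))"
    by (simp add: ac_simps add_mset_commute[of w1 w2])
  with t s have "{#v#} \<approx> add_mset v (add_mset v (s1 + s2 + (y + t)))"
    by (blast intro: graph_cong.trans)
  then show ?thesis by (rule cancels_absorbing)
qed

text \<open>The number of vertices in \<open>C\<close> is not an invariant of \<open>a\<close>, since vertices outside \<open>C\<close> may lead
  into it, but it is constant on the reducts of \<open>v\<close>.  By splitting a common reduct \<open>z\<close> of \<open>a + 2 v\<close>
  and \<open>b + 2 v\<close>, both \<open>a + v\<close> and \<open>b + v\<close> are expressed through \<open>z\<close> alone.\<close>

lemma cancels_cycle: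
  fixes v defines "C \<equiv> {w. (v, w) \<in> (arcs_ends E)\<^sup>* \<and> (w, v) \<in> (arcs_ends E)\<^sup>*}"
  assumes v: "v \<in> verts E"
    and one: "\<And>w. w \<in> C \<Longrightarrow> size (filter_mset (\<lambda>u. u \<in> C) (succs E w)) = 1"
  shows "cancels v"
  unfolding cancels_def
proof (intro allI impI)
  fix a b assume ab: "add_mset v (add_mset v a) \<approx> add_mset v (add_mset v b)"
  let ?f = "\<lambda>x. size (filter_mset (\<lambda>u. u \<in> C) x)"
  have vC: "v \<in> C" by (simp add: C_def)
  have inv: "?f p = 1" if "(fires E)\<^sup>*\<^sup>* {#v#} p" for p
    using that
  proof induction
    case base
    then show ?case using vC by simp
  next
    case (step p q)
    obtain u t where u: "out_arcs E u \<noteq> {}" "p = add_mset u t" "q = succs E u + t"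
      using step.hyps(2) unfolding fires_def by blast
    \<comment> \<open>A vertex of \<open>C\<close> passes its count on to its one successor in \<open>C\<close>; a vertex reached from
      \<open>v\<close> outside \<open>C\<close> cannot return to \<open>v\<close>, so its successors are outside \<open>C\<close> as well.\<close>
    show ?case
    proof (cases "u \<in> C")
      case True
      then show ?thesis using u step.IH one[OF True] by simp
    next
      case False
      have "(v, u) \<in> (arcs_ends E)\<^sup>*" using rtranclp_fires_reach[OF step.hyps(1), of u] u(2) by simp
      then have "w \<notin> C" if "w \<in># succs E u" for w
        using that False set_succs[of u] by (auto simp: C_def intro: converse_rtrancl_into_rtrancl)
      then have "filter_mset (\<lambda>u. u \<in> C) (succs E u) = {#}" by (auto simp: filter_mset_eq_mempty_iff)
      then show ?thesis using u step.IH False by simp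
    qed
  qed
  have "\<exists>d. {#w#} \<approx> add_mset v d" if "w \<in> C" for w
  proof -
    have "w \<in> verts E" using that v reach_verts by (auto simp: C_def)
    then show ?thesis using reach_divides[of w "{#w#}" v] that by (auto simp: C_def)
  qed
  then obtain d where d: "\<And>w. w \<in> C \<Longrightarrow> {#w#} \<approx> add_mset v (d w)" by metis
  \<comment> \<open>\<open>N x\<close> is what remains of \<open>x\<close> once each of its vertices in \<open>C\<close> has been moved along the
    cycle to \<open>v\<close> and these copies of \<open>v\<close> have been taken away.\<close>
  define N where "N x = (\<Sum>w\<in>#x. if w \<in> C then d w else {#w#})" for x
  have N_add: "N (x + y) = N x + N y" for x y by (simp add: N_def)
  have norm: "x \<approx> N x + replicate_mset (?f x) v" if "set_mset x \<subseteq> verts E" for x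
    using that
  proof (induction x)
    case empty
    then show ?case by (simp add: N_def cong_refl)
  next
    case (add w x)
    then have IH: "x \<approx> N x + replicate_mset (?f x) v" by simp
    have "{#w#} \<approx> N {#w#} + replicate_mset (?f {#w#}) v"
      using d[of w] add.prems by (auto simp: N_def cong_refl)
    from graph_cong.add[OF this IH]
    have "{#w#} + x \<approx> N ({#w#} + x) + (replicate_mset (?f {#w#}) v + replicate_mset (?f x) v)"
      by (simp only: N_add ac_simps)
    moreover have "replicate_mset (?f {#w#}) v + replicate_mset (?f x) v =
        replicate_mset (?f (add_mset w x)) v"
      by simp
    ultimately show ?case by simp
  qed
  have split: "\<exists>a1 p q. z = a1 + p + q \<and> (fires E)\<^sup>*\<^sup>* a a1 \<and> (fires E)\<^sup>*\<^sup>* {#v#} p \<and>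
      (fires E)\<^sup>*\<^sup>* {#v#} q" if "(fires E)\<^sup>*\<^sup>* (add_mset v (add_mset v a)) z" for a z
  proof -
    have "(fires E)\<^sup>*\<^sup>* ((a + {#v#}) + {#v#}) z" using that by simp
    from rtranclp_fires_split[OF this] obtain y q where y: "z = y + q" "(fires E)\<^sup>*\<^sup>* (a + {#v#}) y"
      "(fires E)\<^sup>*\<^sup>* {#v#} q" by blast
    with rtranclp_fires_split[OF y(2)] show ?thesis by blast
  qed
  \<comment> \<open>The reducts \<open>p\<close> and \<open>q\<close> of the two copies of \<open>v\<close> satisfy \<open>v = N p + v = N q + v\<close>, so one copy
    of \<open>v\<close> produces both \<open>N p\<close> and \<open>N q\<close>.  As \<open>z\<close> has one vertex of \<open>C\<close> from each of \<open>p\<close> and \<open>q\<close>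
    while only one copy of \<open>v\<close> is present, one is subtracted from the count.\<close>
  have absorb: "add_mset v a \<approx> N z + replicate_mset (?f z - 1) v"
    if fire: "(fires E)\<^sup>*\<^sup>* (add_mset v (add_mset v a)) z" and a: "set_mset a \<subseteq> verts E" for a z
  proof -
    obtain a1 p q where z: "z = a1 + p + q" and f: "(fires E)\<^sup>*\<^sup>* a a1" "(fires E)\<^sup>*\<^sup>* {#v#} p"
      "(fires E)\<^sup>*\<^sup>* {#v#} q" using split[OF fire] by blast
    have loop: "{#v#} \<approx> N p + {#v#}" if "(fires E)\<^sup>*\<^sup>* {#v#} p" for p
    proof -
      have "{#v#} \<approx> p" using that v by (simp add: rtranclp_fires_cong)
      also have "p \<approx> N p + replicate_mset (?f p) v" using norm cong_supp(2)[OF \<open>{#v#} \<approx> p\<close>] .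
      finally show ?thesis using inv[OF that] by simp
    qed
    have a1: "a \<approx> a1" using f(1) a by (rule rtranclp_fires_cong)
    have "a \<approx> N a1 + replicate_mset (?f a1) v"
      using a1 norm[OF cong_supp(2)[OF a1]] by (rule graph_cong.trans)
    moreover have "{#v#} \<approx> N p + N q + {#v#}"
    proof -
      have "{#v#} \<approx> {#v#} + N q" using loop[OF f(3)] by (simp add: ac_simps)
      also have "\<dots> \<approx> (N p + {#v#}) + N q"
        using cong_add_right[OF loop[OF f(2)]] cong_supp(2)[OF loop[OF f(3)]] by simp
      finally show ?thesis by (simp add: ac_simps)
    qed
    ultimately have "a + {#v#} \<approx> (N a1 + replicate_mset (?f a1) v) + (N p + N q + {#v#})"
      by (rule graph_cong.add)
    moreover have "?f z = ?f a1 + 2" using inv f(2,3) z by simp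
    ultimately show ?thesis using z by (simp add: N_add ac_simps)
  qed
  obtain z where z: "(fires E)\<^sup>*\<^sup>* (add_mset v (add_mset v a)) z"
      "(fires E)\<^sup>*\<^sup>* (add_mset v (add_mset v b)) z"
    using graph_cong_imp_joinable[OF ab] by blast
  have "add_mset v a \<approx> N z + replicate_mset (?f z - 1) v"
    "add_mset v b \<approx> N z + replicate_mset (?f z - 1) v"
    using absorb[OF z(1)] absorb[OF z(2)] cong_supp[OF ab] by auto
  then show "add_mset v a \<approx> add_mset v b" by (rule graph_cong.trans[OF _ cong_sym])
qed

lemma cancels_cyclic:
  assumes cyc: "(v, v) \<in> (arcs_ends E)\<^sup>+"
  shows "cancels v"
proof -
  have v: "v \<in> verts E" using cyc by (meson arcs_ends_verts tranclD)
  define C where "C = {w. (v, w) \<in> (arcs_ends E)\<^sup>* \<and> (w, v) \<in> (arcs_ends E)\<^sup>*}"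
  show ?thesis
  proof (cases "\<forall>w\<in>C. size (filter_mset (\<lambda>u. u \<in> C) (succs E w)) = 1")
    case True
    then show ?thesis using cancels_cycle[OF v] unfolding C_def by blast
  next
    case False
    then obtain w where w: "w \<in> C" "size (filter_mset (\<lambda>u. u \<in> C) (succs E w)) \<noteq> 1" by blast
    have "(w, v) \<in> (arcs_ends E)\<^sup>+"
      using w(1) cyc by (auto simp: C_def)
    then obtain u where u: "(w, u) \<in> arcs_ends E" "(u, v) \<in> (arcs_ends E)\<^sup>*"
      by (meson tranclD)
    then have "u \<in> C" using w(1) by (auto simp: C_def intro: rtrancl.rtrancl_into_rtrancl)
    moreover have "u \<in># succs E w" using u(1) set_succs by auto
    ultimately have "u \<in># filter_mset (\<lambda>u. u \<in> C) (succs E w)" by simp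
    then obtain t where t: "filter_mset (\<lambda>u. u \<in> C) (succs E w) = add_mset u t"
      by (meson multi_member_split)
    with w(2) obtain u' t' where "t = add_mset u' t'" by (cases t) auto
    with t have f: "filter_mset (\<lambda>u. u \<in> C) (succs E w) = add_mset u (add_mset u' t')" by simp
    then have "u' \<in># filter_mset (\<lambda>u. u \<in> C) (succs E w)" by simp
    then have "u' \<in> C" by simp
    have "succs E w = add_mset u (add_mset u' (t' + filter_mset (\<lambda>u. u \<notin> C) (succs E w)))"
      using multiset_partition[of "succs E w" "\<lambda>u. u \<in> C"] f by simp
    then show ?thesis
      using cancels_branching[OF v] w(1) \<open>u \<in> C\<close> \<open>u' \<in> C\<close> unfolding C_def by blast
  qed
qed

text \<open>If \<open>v\<close> is on no cycle, then \<open>v\<close> is not reachable from its successors, so fewer vertices are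
  reachable from them than from \<open>v\<close>.  The successors themselves may lie on cycles.\<close>

lemma cancels_if_finite_arcs:
  assumes fin: "finite (arcs E)"
  shows "cancels v"
proof -
  have fin_reach: "finite ((arcs_ends E)\<^sup>* `` {v})" for v
  proof -
    have "(arcs_ends E)\<^sup>* `` {v} \<subseteq> insert v (Range (arcs_ends E))"
      by (auto elim: rtranclE)
    moreover have "finite (arcs_ends E)" using fin by (simp add: arcs_ends_conv)
    ultimately show ?thesis by (meson finite_Range finite_insert finite_subset)
  qed
  show ?thesis
  proof (induction "card ((arcs_ends E)\<^sup>* `` {v})" arbitrary: v rule: less_induct)
    case less
    show ?case
    proof (cases "(v, v) \<in> (arcs_ends E)\<^sup>+")
      case True
      then show ?thesis by (rule cancels_cyclic)
    next
      case False
      have "cancels u" if u: "(v, u) \<in> arcs_ends E" for u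
      proof (rule less.hyps, rule psubset_card_mono[OF fin_reach])
        have "v \<notin> (arcs_ends E)\<^sup>* `` {u}" using u False by (auto intro: rtrancl_into_trancl2)
        moreover have "(arcs_ends E)\<^sup>* `` {u} \<subseteq> (arcs_ends E)\<^sup>* `` {v}"
          using u by (auto intro: converse_rtrancl_into_rtrancl)
        ultimately show "(arcs_ends E)\<^sup>* `` {u} \<subset> (arcs_ends E)\<^sup>* `` {v}" by blast
      qed
      then show ?thesis using cancels_sink cancels_nonsink by blast
    qed
  qed
qed

section \<open>Separativity for finitely many arcs\<close>

lemma graph_cong_separative_if_finite_arcs:
  assumes fin: "finite (arcs E)"
    and abc: "a + c \<approx> b + c"
    and ca: "repeat_mset n a \<approx> c + d" and cb: "repeat_mset n b \<approx> c + d'"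
  shows "a \<approx> b"
proof -
  have dom: "\<exists>c'. (fires E)\<^sup>*\<^sup>* c c' \<and> (\<forall>w\<in>#c'. \<exists>u\<in>#a. (u, w) \<in> (arcs_ends E)\<^sup>*)"
    if "repeat_mset n a \<approx> c + d" for a c d
  proof -
    obtain z where z: "(fires E)\<^sup>*\<^sup>* (repeat_mset n a) z" "(fires E)\<^sup>*\<^sup>* (c + d) z"
      using graph_cong_imp_joinable[OF \<open>repeat_mset n a \<approx> c + d\<close>] by blast
    obtain c' d' where c': "z = c' + d'" "(fires E)\<^sup>*\<^sup>* c c'"
      using rtranclp_fires_split[OF z(2)] by blast
    have "\<exists>u\<in>#a. (u, w) \<in> (arcs_ends E)\<^sup>*" if "w \<in># c'" for w
    proof -
      have "w \<in># z" using that c'(1) by simp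
      then obtain u where "u \<in># repeat_mset n a" "(u, w) \<in> (arcs_ends E)\<^sup>*"
        using rtranclp_fires_reach[OF z(1)] by blast
      moreover from this(1) have "u \<in># a" using set_repeat_mset_subset[of n a] by blast
      ultimately show ?thesis by blast
    qed
    with c'(2) show ?thesis by blast
  qed
  have supp: "set_mset a \<subseteq> verts E" "set_mset b \<subseteq> verts E" "set_mset c \<subseteq> verts E"
    and suppd': "set_mset d' \<subseteq> verts E"
    using cong_supp[OF abc] cong_supp[OF cb] by auto
  \<comment> \<open>First rewrite \<open>c\<close> to vertices reachable from \<open>a\<close>, then rewrite the result to vertices reachable
    from \<open>b\<close>; reachability from \<open>a\<close> survives the second rewriting.\<close>
  obtain c1 where c1: "(fires E)\<^sup>*\<^sup>* c c1" "\<forall>w\<in>#c1. \<exists>u\<in>#a. (u, w) \<in> (arcs_ends E)\<^sup>*"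
    using dom[OF ca] by blast
  have cc1: "c \<approx> c1" using c1(1) supp(3) by (rule rtranclp_fires_cong)
  have "repeat_mset n b \<approx> c1 + d'"
    using cb cong_add_right[OF cc1 suppd'] by (rule graph_cong.trans)
  from dom[OF this] obtain c2 where
    c2: "(fires E)\<^sup>*\<^sup>* c1 c2" "\<forall>w\<in>#c2. \<exists>u\<in>#b. (u, w) \<in> (arcs_ends E)\<^sup>*" by blast
  have "c1 \<approx> c2" using c2(1) cong_supp(2)[OF cc1] by (rule rtranclp_fires_cong)
  with cc1 have cc2: "c \<approx> c2" by (rule graph_cong.trans)
  have c2a: "\<exists>u\<in>#a. (u, w) \<in> (arcs_ends E)\<^sup>*" if "w \<in># c2" for w
    using rtranclp_fires_reach[OF c2(1) that] c1(2) by (meson rtrancl_trans)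
  show ?thesis
  proof (rule cancel_dominated)
    have "a + c2 \<approx> a + c" "b + c \<approx> b + c2"
      using graph_cong.add[OF cong_refl cong_sym[OF cc2], of a]
        graph_cong.add[OF cong_refl cc2, of b] supp by auto
    then show "a + c2 \<approx> b + c2" using abc by (blast intro: graph_cong.trans)
  next
    fix u assume u: "u \<in># c2"
    show "cancels u" by (rule cancels_if_finite_arcs[OF fin])
    show "\<exists>a'. a \<approx> add_mset u a'" using c2a[OF u] reach_divides supp(1) by blast
    show "\<exists>b'. b \<approx> add_mset u b'" using c2(2) u reach_divides supp(2) by blast
  qed
qed

end

section \<open>Reduction to finitely many emitting vertices\<close>

definition restrict_emitters :: "'a set \<Rightarrow> ('a, 'b) pre_digraph \<Rightarrow> ('a, 'b) pre_digraph" where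
  "restrict_emitters S E = E\<lparr>arcs := {e \<in> arcs E. tail E e \<in> S}\<rparr>"

lemma verts_restrict_emitters [simp]: "verts (restrict_emitters S E) = verts E"
  and head_restrict_emitters [simp]: "head (restrict_emitters S E) = head E"
  and out_arcs_restrict_emitters [simp]:
    "out_arcs (restrict_emitters S E) v = (if v \<in> S then out_arcs E v else {})"
  by (auto simp: restrict_emitters_def out_arcs_def)

lemma (in row_finite_digraph) row_finite_restrict_emitters:
  "row_finite_digraph (restrict_emitters S E)"
  by unfold_locales
    (auto simp: restrict_emitters_def out_arcs_def intro: finite_subset[OF _ finite_out_arcs])

lemma (in row_finite_digraph) finite_arcs_restrict_emitters:
  assumes "finite S"
  shows "finite (arcs (restrict_emitters S E))"
proof -
  have "arcs (restrict_emitters S E) = (\<Union>v\<in>S. out_arcs E v)"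
    by (auto simp: restrict_emitters_def)
  then show ?thesis using assms finite_out by simp
qed

lemma graph_cong_restrict_mono:
  assumes "graph_cong (restrict_emitters S E) x y" "S \<subseteq> T"
  shows "graph_cong (restrict_emitters T E) x y"
  using assms(1)
proof induction
  case (gen v)
  then have "v \<in> T" "v \<in> S" using assms(2) by (auto split: if_splits)
  then show ?case using gen graph_cong.gen[of v "restrict_emitters T E"] by simp
next
  case (refl x)
  then show ?case by (intro graph_cong.refl) simp
next
  case (sym x y)
  show ?case by (rule graph_cong.sym[OF sym.IH])
next
  case (trans x y z)
  show ?case by (rule graph_cong.trans[OF trans.IH])
next
  case (add x y x' y')
  show ?case by (rule graph_cong.add[OF add.IH])
qed

lemma restrict_emitters_UNIV: "restrict_emitters UNIV E = E"
  by (simp add: restrict_emitters_def)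

lemma graph_cong_finite_emitters:
  assumes "graph_cong E x y"
  shows "\<exists>S. finite S \<and> graph_cong (restrict_emitters S E) x y"
  using assms
proof induction
  case (gen v)
  then have "graph_cong (restrict_emitters {v} E) {#v#} (succs E v)"
    using graph_cong.gen[of v "restrict_emitters {v} E"] by simp
  then show ?case by blast
next
  case (refl x)
  then have "graph_cong (restrict_emitters {} E) x x" by (intro graph_cong.refl) simp
  then show ?case by blast
next
  case (sym x y)
  then obtain S where "finite S" "graph_cong (restrict_emitters S E) x y" by blast
  then show ?case using graph_cong.sym[of "restrict_emitters S E" x y] by blast
next
  case (trans x y z)
  then obtain S T where ST: "finite S" "finite T" "graph_cong (restrict_emitters S E) x y"
    "graph_cong (restrict_emitters T E) y z" by blast
  have "graph_cong (restrict_emitters (S \<union> T) E) x z"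
    by (rule graph_cong.trans[OF graph_cong_restrict_mono[OF ST(3)] graph_cong_restrict_mono[OF ST(4)]]) auto
  then show ?case using ST by blast
next
  case (add x y x' y')
  then obtain S T where ST: "finite S" "finite T" "graph_cong (restrict_emitters S E) x y"
    "graph_cong (restrict_emitters T E) x' y'" by blast
  have "graph_cong (restrict_emitters (S \<union> T) E) (x + x') (y + y')"
    by (rule graph_cong.add[OF graph_cong_restrict_mono[OF ST(3)] graph_cong_restrict_mono[OF ST(4)]]) auto
  then show ?case using ST by blast
qed

lemma (in row_finite_digraph) graph_cong_separative:
  assumes "a + c \<approx> b + c" "repeat_mset n a \<approx> c + d" "repeat_mset n b \<approx> c + d'"
  shows "a \<approx> b"
proof -
  obtain S1 S2 S3 where S: "finite S1" "finite S2" "finite S3"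
    "graph_cong (restrict_emitters S1 E) (a + c) (b + c)"
    "graph_cong (restrict_emitters S2 E) (repeat_mset n a) (c + d)"
    "graph_cong (restrict_emitters S3 E) (repeat_mset n b) (c + d')"
    using assms[THEN graph_cong_finite_emitters] by blast
  define S where "S = S1 \<union> S2 \<union> S3"
  interpret R: row_finite_digraph "restrict_emitters S E"
    by (rule row_finite_restrict_emitters)
  have "graph_cong (restrict_emitters S E) a b"
  proof (rule R.graph_cong_separative_if_finite_arcs)
    show "finite (arcs (restrict_emitters S E))"
      using S by (simp add: S_def finite_arcs_restrict_emitters)
    show "graph_cong (restrict_emitters S E) (a + c) (b + c)"
      "graph_cong (restrict_emitters S E) (repeat_mset n a) (c + d)"
      "graph_cong (restrict_emitters S E) (repeat_mset n b) (c + d')"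
      by (rule S(4-6)[THEN graph_cong_restrict_mono], auto simp: S_def)+
  qed
  then show ?thesis
    using graph_cong_restrict_mono[of S E a b UNIV] by (simp add: restrict_emitters_UNIV)
qed

section \<open>Separativity of the graph monoid\<close>

lemma graph_monoid_pow:
  assumes "set_mset x \<subseteq> verts E"
  shows "graph_class E x [^]\<^bsub>graph_monoid E\<^esub> (n :: nat) = graph_class E (repeat_mset n x)"
proof (induction n)
  case 0
  then show ?case by (simp add: nat_pow_def graph_monoid_def)
next
  case (Suc n)
  interpret M: comm_monoid "graph_monoid E" by (rule comm_monoid_graph_monoid)
  have "set_mset (repeat_mset n x) \<subseteq> verts E"
    by (rule subset_trans[OF set_repeat_mset_subset assms])
  from graph_monoid_mult[OF this assms] show ?case
    using Suc by (simp add: add.commute)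
qed

theorem theorem6p3:
  fixes E :: "('a, 'b) pre_digraph"
  assumes "row_finite_digraph E"
  shows "separative_monoid (graph_monoid E)"
proof -
  interpret row_finite_digraph E by (rule assms)
  interpret M: comm_monoid "graph_monoid E" by (rule comm_monoid_graph_monoid)
  have carrier: "A \<in> carrier (graph_monoid E) \<longleftrightarrow> (\<exists>x. set_mset x \<subseteq> verts E \<and> A = graph_class E x)" for A
    by (auto simp: graph_monoid_def)
  have divides: "\<exists>d. repeat_mset n x \<approx> y + d"
    if dvd_pow: "graph_class E y divides\<^bsub>graph_monoid E\<^esub> (graph_class E x [^]\<^bsub>graph_monoid E\<^esub> n)"
      and x: "set_mset x \<subseteq> verts E" and y: "set_mset y \<subseteq> verts E" for x y and n :: nat
  proof -
    obtain D where "D \<in> carrier (graph_monoid E)"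
      "graph_class E (repeat_mset n x) = graph_class E y \<otimes>\<^bsub>graph_monoid E\<^esub> D"
      using dvd_pow graph_monoid_pow[OF x, of n] by (auto simp: factor_def)
    then obtain d where d: "set_mset d \<subseteq> verts E"
      "graph_class E (repeat_mset n x) = graph_class E y \<otimes>\<^bsub>graph_monoid E\<^esub> graph_class E d"
      using carrier[of D] by auto
    then have "graph_class E (repeat_mset n x) = graph_class E (y + d)"
      using y by (simp add: graph_monoid_mult)
    then show ?thesis using graph_class_eq_iff[of "y + d" E] y d(1) by auto
  qed
  show ?thesis
  proof
    fix A B C
    assume "A \<in> carrier (graph_monoid E)" "B \<in> carrier (graph_monoid E)"
      "C \<in> carrier (graph_monoid E)"
    then obtain a b c where supp: "set_mset a \<subseteq> verts E" "set_mset b \<subseteq> verts E"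
      "set_mset c \<subseteq> verts E"
      and ABC: "A = graph_class E a" "B = graph_class E b" "C = graph_class E c"
      using carrier[of A] carrier[of B] carrier[of C] by blast
    assume eq: "A \<otimes>\<^bsub>graph_monoid E\<^esub> C = B \<otimes>\<^bsub>graph_monoid E\<^esub> C"
    assume "\<exists>n::nat. n > 0 \<and> C divides\<^bsub>graph_monoid E\<^esub> (A [^]\<^bsub>graph_monoid E\<^esub> n) \<and>
      C divides\<^bsub>graph_monoid E\<^esub> (B [^]\<^bsub>graph_monoid E\<^esub> n)"
    then obtain n d d' where "repeat_mset n a \<approx> c + d" "repeat_mset n b \<approx> c + d'"
      using divides[OF _ supp(1,3)] divides[OF _ supp(2,3)] unfolding ABC by blast
    moreover have "a + c \<approx> b + c"
      using eq ABC supp graph_class_eq_iff[of "b + c" E "a + c"] by (simp add: graph_monoid_mult)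
    ultimately have "a \<approx> b" using graph_cong_separative by blast
    then show "A = B" using ABC graph_class_eq_iff[OF supp(2)] by simp
  qed
qed

end
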